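(* Let $k\ge2$ and let $\mathcal{G}$ and $\mathcal{F}$ be $k$-uniform hypergraphs such that there is no homomorphism from $\mathcal{G}$ to $\mathcal{F}$. Then $$\frac{n^k}{v(\mathcal{F})^k}+o(n^k)\le ex_{\mathcal{F}}(n,\mathcal{G})\le e(\mathcal{F})^{-1}ex_k(n,\mathcal{G})+o(n^k).$$ Moreover, if $\chi(\mathcal{F})=k$, then $ex_{\mathcal{F}}(n,\mathcal{G})=e(\mathcal{F})^{-1}ex_k(n,\mathcal{G})+o(n^k)$.
   Context: For $k$-uniform hypergraphs $\mathcal{F}$ and $\mathcal{G}$, consider $n$-vertex $k$-uniform hypergraphs $\mathcal{R}$ whose edge set is the union of pairwise edge-disjoint subhypergraphs each isomorphic to $\mathcal{F}$ (called $\mathcal{F}$-copies; each is thought of as a single colour). A subhypergraph of $\mathcal{R}$ is rainbow if its edges come from pairwise distinct $\mathcal{F}$-copies. $ex_{\mathcal{F}}(n,\mathcal{G})$ is the maximum number of $\mathcal{F}$-copies in such an $n$-vertex $\mathcal{R}$ with no rainbow copy of $\mathcal{G}$. $ex_k(n,\mathcal{G})$ is the Turán number: the maximum number of edges of an $n$-vertex $k$-uniform hypergraph containing no copy of $\mathcal{G}$. $v(\cdot)$ and $e(\cdot)$ denote numbers of vertices and edges. A homomorphism from $\mathcal{G}$ to $\mathcal{F}$ is a map $\varphi:V(\mathcal{G})\to V(\mathcal{F})$ with $\varphi(e)\in E(\mathcal{F})$ for every $e\in E(\mathcal{G})$. The condition $\chi(\mathcal{F})=k$ is used in the paper to mean that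 $\mathcal{F}$ is $k$-partite: $V(\mathcal{F})$ can be partitioned into $k$ classes such that every edge has exactly one vertex in each class. *)

theory Defs
  imports Complex_Main "HOL-Library.Landau_Symbols" "HOL-Library.Disjoint_Sets"
    "HOL-Library.FuncSet"
begin

record 'a hypergraph =
  verts :: "'a set"
  edges :: "'a set set"

definition uniform_hypergraph :: "nat \<Rightarrow> 'a hypergraph \<Rightarrow> bool" where
  "uniform_hypergraph k H \<longleftrightarrow>
     finite (verts H) \<and> (\<forall>e\<in>edges H. e \<subseteq> verts H \<and> card e = k)"

definition subhypergraph :: "'a hypergraph \<Rightarrow> 'a hypergraph \<Rightarrow> bool" where
  "subhypergraph S R \<longleftrightarrow>
     verts S \<subseteq> verts R \<and> edges S \<subseteq> edges R \<and> (\<forall>e\<in>edges S. e \<subseteq> verts S)"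

definition isomorphic :: "'a hypergraph \<Rightarrow> 'b hypergraph \<Rightarrow> bool" where
  "isomorphic G H \<longleftrightarrow>
     (\<exists>f. bij_betw f (verts G) (verts H) \<and> (\<lambda>e. f ` e) ` edges G = edges H)"

definition homomorphism ::
  "('a \<Rightarrow> 'b) \<Rightarrow> 'a hypergraph \<Rightarrow> 'b hypergraph \<Rightarrow> bool" where
  "homomorphism \<phi> G F \<longleftrightarrow>
     \<phi> \<in> verts G \<rightarrow> verts F \<and> (\<forall>e\<in>edges G. \<phi> ` e \<in> edges F)"

definition is_copy :: "'a hypergraph \<Rightarrow> 'b hypergraph \<Rightarrow> 'b hypergraph \<Rightarrow> bool" where
  "is_copy G S R \<longleftrightarrow> subhypergraph S R \<and> isomorphic G S"

definition k_partite :: "nat \<Rightarrow> 'a hypergraph \<Rightarrow> bool" where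
  "k_partite k H \<longleftrightarrow>
     (\<exists>P. partition_on (verts H) P \<and> card P = k \<and>
          (\<forall>e\<in>edges H. \<forall>A\<in>P. card (e \<inter> A) = 1))"

definition turan_number :: "nat \<Rightarrow> nat \<Rightarrow> 'a hypergraph \<Rightarrow> nat" where
  "turan_number k n G =
     Max {card (edges R) | R :: nat hypergraph.
            uniform_hypergraph k R \<and> card (verts R) = n \<and> (\<nexists>S. is_copy G S R)}"

text \<open>The members of \<open>\<C>\<close> are the colours.\<close>

definition copy_union ::
  "'a hypergraph \<Rightarrow> 'b hypergraph \<Rightarrow> 'b hypergraph set \<Rightarrow> bool" where
  "copy_union F R \<C> \<longleftrightarrow>
     (\<forall>C\<in>\<C>. is_copy F C R) \<and>
     pairwise (\<lambda>C D. edges C \<inter> edges D = {}) \<C> \<and>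
     edges R = (\<Union>C\<in>\<C>. edges C)"

definition rainbow :: "'b hypergraph set \<Rightarrow> 'b hypergraph \<Rightarrow> bool" where
  "rainbow \<C> S \<longleftrightarrow>
     (\<forall>e\<in>edges S. \<forall>e'\<in>edges S. e \<noteq> e' \<longrightarrow>
        \<not> (\<exists>C\<in>\<C>. e \<in> edges C \<and> e' \<in> edges C))"

text \<open>
  In both extremal numbers the vertices are taken from \<^typ>\<open>nat\<close>, which represents every
  isomorphism type of finite hypergraph. Both sets of values are finite
  (\<open>\<C>\<close> consists of subhypergraphs of the finite \<open>R\<close>), and they contain \<open>0\<close>
  (from the edgeless \<open>R\<close>) as soon as \<open>G\<close> has an edge, so \<open>Max\<close> is then a true maximum.
\<close>

definition ex_copies ::
  "nat \<Rightarrow> 'b hypergraph \<Rightarrow> nat \<Rightarrow> 'a hypergraph \<Rightarrow> nat" where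
  "ex_copies k F n G =
     Max {card \<C> | (R :: nat hypergraph) \<C>.
            uniform_hypergraph k R \<and> card (verts R) = n \<and> copy_union F R \<C> \<and>
            (\<nexists>S. is_copy G S R \<and> rainbow \<C> S)}"

end

theory Submission
  imports Defs "HOL-Computational_Algebra.Polynomial"
begin

text \<open>
  Upper bound: call an \<open>m\<close>-set of vertices bad if it contains two edges of one colour; there are
  only \<open>O(n\<^sup>m\<^sup>-\<^sup>1)\<close> of these, and \<open>R\<close> restricted to any other \<open>m\<close>-set contains no copy of \<open>G\<close> at
  all. Averaging over \<open>m\<close>-sets bounds the edge density of \<open>R\<close> by the Turan density at \<open>m\<close>, which
  decreases in \<open>m\<close> and hence converges; no hypergraph removal lemma is needed.

  Lower bound: the balanced blow-up of \<open>F\<close> maps homomorphically to \<open>F\<close>, so it is \<open>G\<close>-free. The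
  codewords of a Reed--Solomon code decompose it into copies of \<open>F\<close>: two codewords that agree in
  \<open>k\<close> positions coincide, so the copies are edge-disjoint.

  If \<open>F\<close> is \<open>k\<close>-partite, Erdos' theorem says that \<open>\<epsilon>n\<^sup>k\<close> edges force a copy of \<open>F\<close>. A maximal
  packing of copies of \<open>F\<close> in an extremal \<open>G\<close>-free hypergraph therefore misses \<open>o(n\<^sup>k)\<close> edges.
\<close>

section \<open>Copies and extremal numbers\<close>

lemma uniform_hypergraph_edge:
  assumes "uniform_hypergraph k H" "e \<in> edges H"
  shows "e \<subseteq> verts H" "card e = k" "finite e"
  using assms by (auto simp: uniform_hypergraph_def intro: finite_subset)

lemma uniform_hypergraph_edges_subset:
  assumes "uniform_hypergraph k H"
  shows "edges H \<subseteq> {e. e \<subseteq> verts H \<and> card e = k}"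
  using assms by (auto simp: uniform_hypergraph_def)

lemma finite_edges:
  assumes "uniform_hypergraph k H"
  shows "finite (edges H)"
proof -
  have "finite (verts H)" using assms by (simp add: uniform_hypergraph_def)
  then have "finite {e. e \<subseteq> verts H \<and> card e = k}" by simp
  then show ?thesis using uniform_hypergraph_edges_subset[OF assms] by (rule rev_finite_subset)
qed

lemma card_edges_le:
  assumes "uniform_hypergraph k H"
  shows "card (edges H) \<le> card (verts H) choose k"
proof -
  have fin: "finite (verts H)" using assms by (simp add: uniform_hypergraph_def)
  then have "card (edges H) \<le> card {e. e \<subseteq> verts H \<and> card e = k}"
    by (intro card_mono uniform_hypergraph_edges_subset[OF assms]) simp
  then show ?thesis using n_subsets[OF fin] by simp
qed

lemma is_copy_image:
  assumes "uniform_hypergraph k F" "inj_on f (verts F)" "f ` verts F \<subseteq> verts R"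
    and "\<And>e. e \<in> edges F \<Longrightarrow> f ` e \<in> edges R"
  shows "is_copy F \<lparr>verts = f ` verts F, edges = (`) f ` edges F\<rparr> R"
  unfolding is_copy_def subhypergraph_def isomorphic_def
proof (intro conjI exI[of _ f])
  show "\<forall>e\<in>edges \<lparr>verts = f ` verts F, edges = (`) f ` edges F\<rparr>.
      e \<subseteq> verts \<lparr>verts = f ` verts F, edges = (`) f ` edges F\<rparr>"
    using assms(1) by (auto simp: uniform_hypergraph_def image_iff)
qed (use assms in \<open>auto simp: inj_on_imp_bij_betw\<close>)

lemma is_copy_mono:
  assumes "is_copy G S R" "verts R \<subseteq> verts R'" "edges R \<subseteq> edges R'"
  shows "is_copy G S R'"
  using assms by (auto simp: is_copy_def subhypergraph_def)

text \<open>An isomorphism onto a subhypergraph of \<open>R\<close> is in particular a homomorphism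
  into \<open>R\<close>. Composed with the projection of a blow-up to \<open>F\<close>, it will rule
  out copies of \<open>G\<close> there.\<close>

lemma is_copy_homomorphism:
  assumes "is_copy G S R"
  obtains f where "homomorphism f G R"
proof -
  from assms obtain f where "bij_betw f (verts G) (verts S)" "(`) f ` edges G = edges S"
    and "verts S \<subseteq> verts R" "edges S \<subseteq> edges R"
    by (auto simp: is_copy_def isomorphic_def subhypergraph_def)
  then have "homomorphism f G R"
    by (fastforce simp: homomorphism_def bij_betw_def)
  then show thesis by (rule that)
qed

lemma is_copy_card_edges:
  assumes "uniform_hypergraph k F" "is_copy F C R"
  shows "card (edges C) = card (edges F)"
proof -
  from assms(2) obtain f where f: "bij_betw f (verts F) (verts C)" "(`) f ` edges F = edges C"
    by (auto simp: is_copy_def isomorphic_def)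
  have "inj_on ((`) f) (edges F)"
  proof (rule inj_on_subset)
    show "inj_on ((`) f) (Pow (verts F))"
      using f(1) by (intro inj_on_image_Pow) (simp add: bij_betw_def)
    show "edges F \<subseteq> Pow (verts F)" using assms(1) by (auto simp: uniform_hypergraph_def)
  qed
  from card_image[OF this] show ?thesis unfolding f(2) .
qed

lemma no_copy_edgeless:
  assumes "edges G \<noteq> {}" "edges R = {}"
  shows "\<not> is_copy G S R"
  using assms by (auto simp: is_copy_def subhypergraph_def isomorphic_def)

text \<open>A constant map to a vertex of \<open>F\<close> is a homomorphism from any edgeless
  \<open>G\<close>. An edge of \<open>G\<close> is what makes the sets behind both extremal numbers
  nonempty.\<close>

lemma edges_nonempty_if_no_homomorphism:
  assumes "k \<ge> 1" "uniform_hypergraph k F" "edges F \<noteq> {}" "\<nexists>\<phi>. homomorphism \<phi> G F"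
  shows "edges G \<noteq> {}"
proof
  assume G: "edges G = {}"
  obtain e where "e \<in> edges F" using assms(3) by auto
  with assms(1,2) obtain x where "x \<in> verts F"
    using uniform_hypergraph_edge[of k F e] by (metis card.empty not_one_le_zero subsetD ex_in_conv)
  with G have "homomorphism (\<lambda>_. x) G F" by (auto simp: homomorphism_def)
  with assms(4) show False by blast
qed

section \<open>Both extremal numbers as attained maxima\<close>

lemma finite_turan_set:
  "finite {card (edges R) | R :: nat hypergraph.
     uniform_hypergraph k R \<and> card (verts R) = n \<and> (\<nexists>S. is_copy G S R)}"
proof (rule finite_subset)
  show "{card (edges R) | R :: nat hypergraph.
     uniform_hypergraph k R \<and> card (verts R) = n \<and> (\<nexists>S. is_copy G S R)} \<subseteq> {..n choose k}"
    using card_edges_le by fastforce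
qed simp

lemma turan_number_ge:
  fixes R :: "nat hypergraph"
  assumes "uniform_hypergraph k R" "card (verts R) = n" "\<nexists>S. is_copy G S R"
  shows "card (edges R) \<le> turan_number k n G"
  unfolding turan_number_def using assms by (intro Max_ge finite_turan_set) blast

text \<open>The edgeless hypergraph on \<open>n\<close> vertices shows that the maximum is over a
  nonempty set; it is \<open>G\<close>-free because \<open>G\<close> has an edge.\<close>

lemma turan_number_attained:
  assumes "edges G \<noteq> {}"
  obtains R :: "nat hypergraph" where "uniform_hypergraph k R" "card (verts R) = n"
    "\<nexists>S. is_copy G S R" "card (edges R) = turan_number k n G"
proof -
  let ?A = "{card (edges R) | R :: nat hypergraph.
     uniform_hypergraph k R \<and> card (verts R) = n \<and> (\<nexists>S. is_copy G S R)}"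
  let ?R = "\<lparr>verts = {..<n}, edges = {}\<rparr>"
  have "uniform_hypergraph k ?R" "card (verts ?R) = n" "\<nexists>S. is_copy G S ?R"
    using no_copy_edgeless[OF assms, of ?R] by (auto simp: uniform_hypergraph_def)
  then have "?A \<noteq> {}" by blast
  then have "Max ?A \<in> ?A" by (intro Max_in finite_turan_set)
  then show thesis using that unfolding turan_number_def by auto
qed

text \<open>Edge-disjointness makes the edge counts of the colours add up. This is the exchange rate
  between colours and edges used throughout.\<close>

lemma copy_union_card:
  assumes "uniform_hypergraph k R" "uniform_hypergraph k F" "edges F \<noteq> {}" "copy_union F R \<C>"
  shows "finite \<C>" "card (edges R) = card \<C> * card (edges F)"
proof -
  have ne: "card (edges C) = card (edges F)" if "C \<in> \<C>" for C
    using is_copy_card_edges[OF assms(2)] assms(4) that by (auto simp: copy_union_def)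
  have pos: "card (edges F) > 0" using finite_edges[OF assms(2)] assms(3) by (simp add: card_gt_0_iff)
  have fin: "finite (edges R)" by (rule finite_edges[OF assms(1)])
  \<comment> \<open>Distinct colours are edge-disjoint, so a common edge set would be empty, whereas
    every copy of \<open>F\<close> has an edge.\<close>
  have inj: "inj_on edges \<C>"
  proof (rule inj_onI, rule ccontr)
    fix C D assume "C \<in> \<C>" "D \<in> \<C>" "edges C = edges D" "C \<noteq> D"
    then have "edges C = {}"
      using assms(4) unfolding copy_union_def pairwise_def by (metis Int_absorb)
    with ne[OF \<open>C \<in> \<C>\<close>] pos show False by simp
  qed
  have "edges ` \<C> \<subseteq> Pow (edges R)" using assms(4) by (auto simp: copy_union_def)
  then have "finite (edges ` \<C>)" using fin by (meson finite_Pow_iff finite_subset)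
  then show finC: "finite \<C>" using inj by (rule finite_imageD)
  have "card (\<Union>C\<in>\<C>. edges C) = (\<Sum>C\<in>\<C>. card (edges C))"
  proof (rule card_UN_disjoint[OF finC])
    show "\<forall>C\<in>\<C>. finite (edges C)" using assms(4) fin
      by (auto simp: copy_union_def intro: finite_subset)
    show "\<forall>C\<in>\<C>. \<forall>D\<in>\<C>. C \<noteq> D \<longrightarrow> edges C \<inter> edges D = {}"
      using assms(4) by (auto simp: copy_union_def pairwise_def)
  qed
  also have "\<dots> = card \<C> * card (edges F)" using ne by simp
  finally show "card (edges R) = card \<C> * card (edges F)"
    using assms(4) by (simp add: copy_union_def)
qed

lemma finite_ex_copies_set:
  assumes "uniform_hypergraph k F" "edges F \<noteq> {}"
  shows "finite {card \<C> | (R :: nat hypergraph) \<C>.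
     uniform_hypergraph k R \<and> card (verts R) = n \<and> copy_union F R \<C> \<and>
     (\<nexists>S. is_copy G S R \<and> rainbow \<C> S)}"
proof (rule finite_subset)
  have pos: "card (edges F) \<ge> 1" using finite_edges[OF assms(1)] assms(2)
    by (simp add: Suc_le_eq card_gt_0_iff)
  have "card \<C> \<le> card (verts R) choose k" if "uniform_hypergraph k R" "copy_union F R \<C>"
    for R :: "nat hypergraph" and \<C>
  proof -
    have "card \<C> * 1 \<le> card \<C> * card (edges F)" using pos by (rule mult_le_mono2)
    then show ?thesis
      using copy_union_card(2)[OF that(1) assms that(2)] card_edges_le[OF that(1)] by linarith
  qed
  then show "{card \<C> | (R :: nat hypergraph) \<C>.
     uniform_hypergraph k R \<and> card (verts R) = n \<and> copy_union F R \<C> \<and>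
     (\<nexists>S. is_copy G S R \<and> rainbow \<C> S)} \<subseteq> {..n choose k}"
    by auto
qed simp

lemma ex_copies_ge:
  fixes R :: "nat hypergraph"
  assumes "uniform_hypergraph k F" "edges F \<noteq> {}"
    and "uniform_hypergraph k R" "card (verts R) = n" "copy_union F R \<C>"
    and "\<nexists>S. is_copy G S R \<and> rainbow \<C> S"
  shows "card \<C> \<le> ex_copies k F n G"
  unfolding ex_copies_def using assms(3-) by (intro Max_ge finite_ex_copies_set[OF assms(1,2)]) blast

lemma ex_copies_attained:
  assumes "uniform_hypergraph k F" "edges F \<noteq> {}" "edges G \<noteq> {}"
  obtains R :: "nat hypergraph" and \<C> where
    "uniform_hypergraph k R" "card (verts R) = n" "copy_union F R \<C>"
    "\<nexists>S. is_copy G S R \<and> rainbow \<C> S" "card \<C> = ex_copies k F n G"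
proof -
  let ?A = "{card \<C> | (R :: nat hypergraph) \<C>.
     uniform_hypergraph k R \<and> card (verts R) = n \<and> copy_union F R \<C> \<and>
     (\<nexists>S. is_copy G S R \<and> rainbow \<C> S)}"
  let ?R = "\<lparr>verts = {..<n}, edges = {}\<rparr>"
  have "uniform_hypergraph k ?R" "card (verts ?R) = n" "copy_union F ?R {}"
    "\<nexists>S. is_copy G S ?R \<and> rainbow {} S"
    using no_copy_edgeless[OF assms(3), of ?R]
    by (auto simp: uniform_hypergraph_def copy_union_def)
  then have "?A \<noteq> {}" by blast
  then have "Max ?A \<in> ?A" by (intro Max_in finite_ex_copies_set[OF assms(1,2)])
  then show thesis using that unfolding ex_copies_def by auto
qed

section \<open>Sampling\<close>

lemma card_supersets_of_size:
  assumes "finite V" "S \<subseteq> V" "card S \<le> m"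
  shows "card {M. M \<subseteq> V \<and> card M = m \<and> S \<subseteq> M} = (card V - card S) choose (m - card S)"
proof -
  have fS: "finite S" using assms finite_subset by blast
  have "bij_betw (\<lambda>M. M - S) {M. M \<subseteq> V \<and> card M = m \<and> S \<subseteq> M}
      {N. N \<subseteq> V - S \<and> card N = m - card S}"
  proof (rule bij_betw_byWitness[where f' = "\<lambda>N. N \<union> S"])
    show "(\<lambda>M. M - S) ` {M. M \<subseteq> V \<and> card M = m \<and> S \<subseteq> M}
        \<subseteq> {N. N \<subseteq> V - S \<and> card N = m - card S}"
      using fS by (auto simp: card_Diff_subset)
    show "(\<lambda>N. N \<union> S) ` {N. N \<subseteq> V - S \<and> card N = m - card S}
        \<subseteq> {M. M \<subseteq> V \<and> card M = m \<and> S \<subseteq> M}"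
    proof clarify
      fix N assume N: "N \<subseteq> V - S" "card N = m - card S"
      then have "finite N" using assms(1) by (meson finite_Diff finite_subset)
      then have "card (N \<union> S) = card N + card S" using fS N by (intro card_Un_disjoint) auto
      then show "N \<union> S \<subseteq> V \<and> card (N \<union> S) = m \<and> S \<subseteq> N \<union> S" using N assms by auto
    qed
  qed auto
  then have "card {M. M \<subseteq> V \<and> card M = m \<and> S \<subseteq> M} = card {N. N \<subseteq> V - S \<and> card N = m - card S}"
    by (rule bij_betw_same_card)
  also have "\<dots> = (card V - card S) choose (m - card S)"
    using n_subsets[of "V - S" "m - card S"] assms fS by (simp add: card_Diff_subset)
  finally show ?thesis .
qed

text \<open>\<open>B\<close> collects the \<open>m\<close>-sets on which the bound \<open>t\<close> may fail.\<close>

lemma card_le_by_sampling: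
  assumes "finite V" "k \<le> m" "E \<subseteq> {e. e \<subseteq> V \<and> card e = k}" "finite B"
    and "\<And>M. M \<subseteq> V \<Longrightarrow> card M = m \<Longrightarrow> M \<notin> B \<Longrightarrow> card {e\<in>E. e \<subseteq> M} \<le> t"
  shows "card E * ((card V - k) choose (m - k)) \<le> (card V choose m) * t + card B * (m choose k)"
proof -
  define \<M> where "\<M> = {M. M \<subseteq> V \<and> card M = m}"
  have fin: "finite \<M>" unfolding \<M>_def using assms(1) by simp
  have finE: "finite E" using assms(1,3) by (auto intro: finite_subset[of _ "Pow V"])
  have local: "card {e\<in>E. e \<subseteq> M} \<le> t + (if M \<in> B then m choose k else 0)" if "M \<in> \<M>" for M
  proof (cases "M \<in> B")
    case True
    have fM: "finite M" using that assms(1) unfolding \<M>_def by (auto intro: finite_subset)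
    have "card {e\<in>E. e \<subseteq> M} \<le> card {e. e \<subseteq> M \<and> card e = k}"
      using assms(3) fM by (intro card_mono) auto
    also have "\<dots> = m choose k" using n_subsets[OF fM] that by (simp add: \<M>_def)
    finally show ?thesis using True by simp
  next
    case False
    then show ?thesis using that assms(5) by (simp add: \<M>_def)
  qed
  \<comment> \<open>Double counting of the incidences \<open>e \<subseteq> M\<close>: every edge
    lies in the same number of \<open>m\<close>-sets.\<close>
  have "card E * ((card V - k) choose (m - k)) = (\<Sum>e\<in>E. card {M\<in>\<M>. e \<subseteq> M})"
  proof -
    have "card {M\<in>\<M>. e \<subseteq> M} = (card V - k) choose (m - k)" if "e \<in> E" for e
      using card_supersets_of_size[OF assms(1), of e m] assms(2,3) that
      by (auto simp: \<M>_def conj_assoc)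
    then show ?thesis by simp
  qed
  also have "\<dots> = (\<Sum>M\<in>\<M>. card {e\<in>E. e \<subseteq> M})"
    by (rule sum_multicount_gen) (use fin finE in auto)
  also have "\<dots> \<le> (\<Sum>M\<in>\<M>. t + (if M \<in> B then m choose k else 0))"
    by (rule sum_mono[OF local])
  also have "\<dots> = card \<M> * t + card (\<M> \<inter> B) * (m choose k)"
    using fin by (simp add: sum.distrib sum.If_cases Int_def)
  also have "\<dots> \<le> (card V choose m) * t + card B * (m choose k)"
    using n_subsets[OF assms(1), of m] card_mono[OF assms(4), of "\<M> \<inter> B"]
    by (auto simp: \<M>_def intro!: add_mono mult_right_mono)
  finally show ?thesis .
qed

section \<open>Bounds from induced subhypergraphs\<close>

text \<open>The hypothesis only excludes copies of \<open>G\<close> whose edges lie in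
  \<open>M\<close>; elsewhere \<open>R\<close> may contain \<open>G\<close>. This is the situation
  on a set \<open>M\<close> where every copy would be rainbow.\<close>

lemma turan_number_restrict:
  fixes R :: "nat hypergraph"
  assumes "uniform_hypergraph k R" "M \<subseteq> verts R"
    and "\<nexists>S. is_copy G S R \<and> (\<forall>e\<in>edges S. e \<subseteq> M)"
  shows "card {e\<in>edges R. e \<subseteq> M} \<le> turan_number k (card M) G"
proof -
  let ?R = "\<lparr>verts = M, edges = {e\<in>edges R. e \<subseteq> M}\<rparr>"
  have "uniform_hypergraph k ?R" using assms(1,2)
    by (auto simp: uniform_hypergraph_def intro: finite_subset)
  moreover have "\<nexists>S. is_copy G S ?R"
  proof
    assume "\<exists>S. is_copy G S ?R"
    then obtain S where "is_copy G S ?R" by blast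
    moreover from this have "\<forall>e\<in>edges S. e \<subseteq> M" by (auto simp: is_copy_def subhypergraph_def)
    moreover have "is_copy G S R"
      by (rule is_copy_mono[OF \<open>is_copy G S ?R\<close>]) (use assms(2) in auto)
    ultimately show False using assms(3) by blast
  qed
  ultimately show ?thesis using turan_number_ge[of k ?R "card M" G] by simp
qed

text \<open>The averaging argument of Katona, Nemetz and Simonovits: every \<open>m\<close>-set of
  an extremal hypergraph on \<open>n\<close> vertices induces a \<open>G\<close>-free hypergraph, so
  sampling applies with an empty set of exceptions.\<close>

lemma turan_number_density_antimono:
  assumes "edges G \<noteq> {}" "k \<le> m" "m \<le> n"
  shows "turan_number k n G / (n choose k) \<le> turan_number k m G / (m choose k)"
proof -
  obtain R :: "nat hypergraph" where R: "uniform_hypergraph k R" "card (verts R) = n"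
    "\<nexists>S. is_copy G S R" "card (edges R) = turan_number k n G"
    using turan_number_attained[OF assms(1)] .
  have fV: "finite (verts R)" using R(1) by (simp add: uniform_hypergraph_def)
  have "card {e \<in> edges R. e \<subseteq> M} \<le> turan_number k m G" if "M \<subseteq> verts R" "card M = m" for M
    using turan_number_restrict[OF R(1) that(1), of G] R(3) that(2) by blast
  then have "card (edges R) * ((card (verts R) - k) choose (m - k))
      \<le> (card (verts R) choose m) * turan_number k m G + card ({} :: nat set set) * (m choose k)"
    by (intro card_le_by_sampling[OF fV assms(2) uniform_hypergraph_edges_subset[OF R(1)]]) auto
  then have *: "turan_number k n G * ((n - k) choose (m - k)) \<le> (n choose m) * turan_number k m G"
    using R by simp
  \<comment> \<open>The factor \<open>m choose k\<close> is inserted so that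
    \<open>choose_mult\<close> produces the common factor \<open>(n - k) choose (m - k)\<close>,
    which then cancels.\<close>
  have "turan_number k n G * (m choose k) * ((n - k) choose (m - k))
      \<le> (n choose m) * (m choose k) * turan_number k m G"
    using mult_right_mono[OF *, of "m choose k"] by (simp add: mult_ac)
  also have "\<dots> = turan_number k m G * (n choose k) * ((n - k) choose (m - k))"
    using choose_mult[OF assms(2,3)] by (simp add: mult_ac)
  finally have "turan_number k n G * (m choose k) \<le> turan_number k m G * (n choose k)"
    using assms by (simp add: zero_less_binomial_iff)
  then have "real (turan_number k n G) * real (m choose k) \<le> real (turan_number k m G) * real (n choose k)"
    by (metis of_nat_le_iff of_nat_mult)
  then show ?thesis using assms by (simp add: divide_le_eq le_divide_eq field_simps)
qed

text \<open>Two distinct edges span at least \<open>k + 1\<close> vertices, so a pair of equally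
  coloured edges lies in at most \<open>(n - Suc k) choose (m - Suc k)\<close> of the
  \<open>m\<close>-sets. Each colour has at most \<open>(card (edges F))\<^sup>2\<close> ordered
  pairs, which gives the last summand.\<close>

lemma ex_copies_sampling:
  assumes "uniform_hypergraph k F" "edges F \<noteq> {}" "edges G \<noteq> {}" "k < m" "m \<le> n"
  shows "card (edges F) * ex_copies k F n G * ((n - k) choose (m - k))
    \<le> (n choose m) * turan_number k m G
      + ex_copies k F n G * (card (edges F))\<^sup>2 * ((n - Suc k) choose (m - Suc k)) * (m choose k)"
proof -
  obtain R :: "nat hypergraph" and \<C> where R: "uniform_hypergraph k R" "card (verts R) = n"
    "copy_union F R \<C>" "\<nexists>S. is_copy G S R \<and> rainbow \<C> S" "card \<C> = ex_copies k F n G"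
    using ex_copies_attained[OF assms(1-3)] .
  define I where "I = (SIGMA C:\<C>. {p \<in> edges C \<times> edges C. fst p \<noteq> snd p})"
  define B where "B = (\<Union>(C, e, e')\<in>I. {M. M \<subseteq> verts R \<and> card M = m \<and> e \<union> e' \<subseteq> M})"
  have fV: "finite (verts R)" using R(1) by (simp add: uniform_hypergraph_def)
  have finC: "finite \<C>" using copy_union_card[OF R(1) assms(1,2) R(3)] by blast
  have finE: "finite (edges C)" "edges C \<subseteq> edges R" "card (edges C) = card (edges F)" if "C \<in> \<C>" for C
    using that R(3) is_copy_card_edges[OF assms(1)] finite_edges[OF R(1)]
    by (auto simp: copy_union_def intro: finite_subset)
  have finI: "finite I" unfolding I_def using finC finE by (intro finite_SigmaI) auto
  have cardI: "card I \<le> card \<C> * (card (edges F))\<^sup>2"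
  proof -
    have "card I = (\<Sum>C\<in>\<C>. card {p \<in> edges C \<times> edges C. fst p \<noteq> snd p})"
      unfolding I_def using finC finE by (intro card_SigmaI) auto
    also have "\<dots> \<le> (\<Sum>C\<in>\<C>. (card (edges F))\<^sup>2)"
    proof (rule sum_mono)
      fix C assume "C \<in> \<C>"
      then have "card {p \<in> edges C \<times> edges C. fst p \<noteq> snd p} \<le> card (edges C \<times> edges C)"
        using finE by (intro card_mono) auto
      then show "card {p \<in> edges C \<times> edges C. fst p \<noteq> snd p} \<le> (card (edges F))\<^sup>2"
        using finE \<open>C \<in> \<C>\<close> by (simp add: card_cartesian_product power2_eq_square)
    qed
    finally show ?thesis by simp
  qed
  have finB: "finite B" unfolding B_def using finI fV by (intro finite_UN_I) auto
  have "card B \<le> (\<Sum>(C, e, e')\<in>I. card {M. M \<subseteq> verts R \<and> card M = m \<and> e \<union> e' \<subseteq> M})"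
    unfolding B_def using card_UN_le[OF finI, of "\<lambda>(C, e, e'). {M. M \<subseteq> verts R \<and> card M = m \<and> e \<union> e' \<subseteq> M}"]
    by (simp add: case_prod_beta')
  also have "\<dots> \<le> (\<Sum>_\<in>I. (n - Suc k) choose (m - Suc k))"
  proof (rule sum_mono, clarify)
    fix C e e' assume "(C, e, e') \<in> I"
    then have e: "e \<in> edges R" "e' \<in> edges R" "e \<noteq> e'" using finE unfolding I_def by auto
    note e1 = uniform_hypergraph_edge[OF R(1) e(1)] and e2 = uniform_hypergraph_edge[OF R(1) e(2)]
    \<comment> \<open>One vertex \<open>x\<close> of \<open>e'\<close> outside \<open>e\<close>
      suffices: supersets of \<open>insert x e\<close>, a set of size exactly \<open>k + 1\<close>,
      can be counted exactly.\<close>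
    have "\<not> e' \<subseteq> e" using e(3) e1 e2 by (metis card_subset_eq)
    then obtain x where x: "x \<in> e'" "x \<notin> e" by blast
    have "card {M. M \<subseteq> verts R \<and> card M = m \<and> e \<union> e' \<subseteq> M}
        \<le> card {M. M \<subseteq> verts R \<and> card M = m \<and> insert x e \<subseteq> M}"
      using x fV by (intro card_mono) auto
    also have "\<dots> = (n - Suc k) choose (m - Suc k)"
      using card_supersets_of_size[OF fV, of "insert x e" m] x e1 e2 R(2) assms(4) by auto
    finally show "card {M. M \<subseteq> verts R \<and> card M = m \<and> e \<union> e' \<subseteq> M} \<le> (n - Suc k) choose (m - Suc k)" .
  qed
  also have "\<dots> = card I * ((n - Suc k) choose (m - Suc k))" by simp
  also have "\<dots> \<le> card \<C> * (card (edges F))\<^sup>2 * ((n - Suc k) choose (m - Suc k))"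
    using cardI by (rule mult_le_mono1)
  finally have cardB: "card B \<le> card \<C> * (card (edges F))\<^sup>2 * ((n - Suc k) choose (m - Suc k))" .
  have "card (edges R) * ((card (verts R) - k) choose (m - k))
      \<le> (card (verts R) choose m) * turan_number k m G + card B * (m choose k)"
  proof (rule card_le_by_sampling[OF fV _ uniform_hypergraph_edges_subset[OF R(1)] finB])
    fix M assume M: "M \<subseteq> verts R" "card M = m" "M \<notin> B"
    \<comment> \<open>Two equally coloured edges of a copy inside \<open>M\<close> would put
      \<open>M\<close> into \<open>B\<close>. Hence every copy inside a good set is rainbow, and
      \<open>R\<close> has no such copy.\<close>
    have "rainbow \<C> S" if "is_copy G S R" "\<forall>e\<in>edges S. e \<subseteq> M" for S
      unfolding rainbow_def
    proof (intro ballI impI notI)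
      fix e e' assume e: "e \<in> edges S" "e' \<in> edges S" "e \<noteq> e'" "\<exists>C\<in>\<C>. e \<in> edges C \<and> e' \<in> edges C"
      then obtain C where "(C, e, e') \<in> I" by (auto simp: I_def)
      moreover have "e \<union> e' \<subseteq> M" using e that(2) by blast
      ultimately have "M \<in> B" using M(1,2) unfolding B_def by blast
      with M(3) show False by simp
    qed
    with R(4) show "card {e \<in> edges R. e \<subseteq> M} \<le> turan_number k m G"
      using turan_number_restrict[OF R(1) M(1), of G] M(2) by blast
  qed (use assms in simp)
  also have "\<dots> \<le> (n choose m) * turan_number k m G
      + card \<C> * (card (edges F))\<^sup>2 * ((n - Suc k) choose (m - Suc k)) * (m choose k)"
    using mult_le_mono1[OF cardB, of "m choose k"] R(2) by simp
  finally show ?thesis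
    using copy_union_card(2)[OF R(1) assms(1,2) R(3)] R(2,5) by (simp add: mult_ac)
qed

section \<open>Reed--Solomon codes\<close>

text \<open>A polynomial with more roots than its degree vanishes, here modulo \<open>m\<close>. The
  integers mod \<open>m\<close> may have zero divisors, so the points are required to differ by
  units; then linear factors can be split off one root at a time.\<close>

lemma dvd_coeff_if_dvd_values:
  fixes p :: "int poly"
  assumes "finite I" "degree p < card I"
    and "\<And>i. i \<in> I \<Longrightarrow> m dvd poly p i"
    and "\<And>i j. i \<in> I \<Longrightarrow> j \<in> I \<Longrightarrow> i \<noteq> j \<Longrightarrow> coprime (i - j) m"
  shows "m dvd coeff p n"
  using assms
proof (induction "card I" arbitrary: I p n)
  case 0
  then show ?case by simp
next
  case (Suc r)
  then obtain a where a: "a \<in> I" by (metis card.empty ex_in_conv nat.distinct(1))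
  define q where "q = synthetic_div p a"
  have p: "p = [:poly p a:] + [:-a, 1:] * q"
    unfolding q_def by (metis synthetic_div_correct' add.commute)
  have ma: "m dvd poly p a" using Suc.prems(3) a by simp
  have cI: "card (I - {a}) = r" using Suc.hyps(2) a Suc.prems(1) by (simp)
  have q: "m dvd coeff q j" for j
  \<comment> \<open>For a single point the degree bound would have to be below zero, so the
    induction hypothesis does not cover it; there \<open>p\<close> is constant and \<open>q\<close>
    vanishes.\<close>
  proof (cases "r = 0")
    case True
    then have "degree p = 0" using Suc.prems(2) Suc.hyps(2) by simp
    then have "q = 0" unfolding q_def by (simp add: synthetic_div_eq_0_iff)
    then show ?thesis by simp
  next
    case False
    show ?thesis
    proof (rule Suc.hyps(1)[of "I - {a}"])
      show "r = card (I - {a})" using cI by simp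
      show "finite (I - {a})" using Suc.prems(1) by simp
      show "degree q < card (I - {a})"
        using False Suc.prems(2) Suc.hyps(2) cI unfolding q_def by (simp add: degree_synthetic_div)
      show "m dvd poly q i" if "i \<in> I - {a}" for i
      proof -
        \<comment> \<open>The factor \<open>i - a\<close> is coprime to \<open>m\<close>, so
          divisibility passes from the values of \<open>p\<close> to those of
          \<open>q\<close>.\<close>
        have "poly p i = poly p a + (i - a) * poly q i" by (subst p) (simp add: algebra_simps)
        then have "(i - a) * poly q i = poly p i - poly p a" by simp
        also have "m dvd \<dots>" using ma Suc.prems(3) that by (intro dvd_diff) auto
        finally have "m dvd (i - a) * poly q i" .
        moreover have "coprime m (i - a)" using Suc.prems(4)[of i a] that a by (simp add: coprime_commute)
        ultimately show ?thesis by (simp add: coprime_dvd_mult_right_iff)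
      qed
    qed (use Suc.prems(4) in auto)
  qed
  have "coeff p n = coeff [:poly p a:] n + (coeff (pCons 0 q) n - a * coeff q n)"
    by (subst p) simp
  also have "m dvd \<dots>" using q ma
    by (intro dvd_add dvd_diff dvd_mult) (auto simp: coeff_pCons split: nat.splits)
  finally show ?case .
qed

text \<open>Reed--Solomon codes, over \<open>\<int>/m\<close> with \<open>m\<close> coprime to \<open>v!\<close> so that no prime is needed.\<close>

lemma exists_mds_code:
  fixes k v m :: nat
  assumes "k \<ge> 1" "k \<le> v" "m \<ge> 1" "coprime m (fact v)"
  obtains W :: "(nat \<Rightarrow> nat) set" where "finite W" "card W = m ^ k"
    "\<And>w i. w \<in> W \<Longrightarrow> w i < m"
    "\<And>w w'. w \<in> W \<Longrightarrow> w' \<in> W \<Longrightarrow> w \<noteq> w' \<Longrightarrow> card {i. i < v \<and> w i = w' i} < k"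
proof -
  define A where "A = {..<k} \<rightarrow>\<^sub>E {..<m}"
  \<comment> \<open>The value at \<open>i\<close>, reduced mod \<open>m\<close>, of the polynomial
    with coefficient vector \<open>c\<close>. Words are functions on all naturals, but only the
    positions \<open>i < v\<close> count for the distance.\<close>
  define word :: "(nat \<Rightarrow> nat) \<Rightarrow> nat \<Rightarrow> nat" where "word c i = (\<Sum>j<k. c j * i ^ j) mod m" for c i
  have determined: "c = c'" if c: "c \<in> A" "c' \<in> A" and agree: "card {i. i < v \<and> word c i = word c' i} \<ge> k"
    for c c'
  proof (rule ext)
    fix j
    \<comment> \<open>The difference of the two polynomials has degree below \<open>k\<close> and a
      root mod \<open>m\<close> at each of the \<open>k\<close> or more positions of
      agreement.\<close>
    define p where "p = (\<Sum>j<k. monom (int (c j) - int (c' j)) j)"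
    define I where "I = int ` {i. i < v \<and> word c i = word c' i}"
    have coeff: "coeff p j = (if j < k then int (c j) - int (c' j) else 0)" for j
      unfolding p_def by (simp add: coeff_sum)
    have "int m dvd coeff p j" for j
    proof (rule dvd_coeff_if_dvd_values)
      show "finite I" by (simp add: I_def)
      have "degree p < k"
        using assms(1) by (intro degree_lessI) (auto simp: coeff)
      also have "k \<le> card I" using agree by (simp add: I_def card_image)
      finally show "degree p < card I" .
    next
      fix i assume "i \<in> I"
      then obtain x where x: "i = int x" "word c x = word c' x" by (auto simp: I_def)
      have "poly p i = int (\<Sum>j<k. c j * x ^ j) - int (\<Sum>j<k. c' j * x ^ j)"
        by (simp add: p_def poly_sum poly_monom x left_diff_distrib sum_subtractf)
      moreover have "int (\<Sum>j<k. c j * x ^ j) mod int m = int (\<Sum>j<k. c' j * x ^ j) mod int m"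
        using x(2) by (metis word_def zmod_int)
      ultimately show "int m dvd poly p i" by (simp add: mod_eq_dvd_iff)
    next
      fix i j assume "i \<in> I" "j \<in> I" "i \<noteq> j"
      \<comment> \<open>Distinct positions below \<open>v\<close> differ by some number between 1
        and \<open>v - 1\<close>, which divides \<open>fact v\<close> and is therefore a unit mod
        \<open>m\<close>.\<close>
      then have "nat \<bar>i - j\<bar> dvd fact v" by (intro dvd_fact) (auto simp: I_def)
      then have "coprime (nat \<bar>i - j\<bar>) m" using assms(4) coprime_commute coprime_divisors
        by (metis dvd_refl)
      then show "coprime (i - j) (int m)"
        by (metis coprime_int_iff abs_ge_zero coprime_abs_left_iff nat_0_le)
    qed
    from this[of j] coeff[of j] have "j < k \<Longrightarrow> int (c j) mod int m = int (c' j) mod int m"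
      by (simp add: mod_eq_dvd_iff)
    \<comment> \<open>Coefficients are below \<open>m\<close>, so congruent ones are equal; from
      \<open>k\<close> on, both vectors are \<open>undefined\<close>.\<close>
    then show "c j = c' j"
      using c by (cases "j < k") (fastforce simp: A_def PiE_iff extensional_def simp flip: zmod_int)+
  qed
  have inj: "inj_on word A"
  proof (rule inj_onI)
    fix c c' assume "c \<in> A" "c' \<in> A" "word c = word c'"
    then show "c = c'" using assms(2) by (intro determined) auto
  qed
  show thesis
  proof (rule that[of "word ` A"])
    show "finite (word ` A)" unfolding A_def by (intro finite_imageI finite_PiE) auto
    show "card (word ` A) = m ^ k" using card_image[OF inj] by (simp add: A_def card_PiE)
    show "w i < m" if "w \<in> word ` A" for w i using that assms(3) by (auto simp: word_def)
    show "card {i. i < v \<and> w i = w' i} < k" if "w \<in> word ` A" "w' \<in> word ` A" "w \<noteq> w'" for w w'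
    proof (rule ccontr)
      assume *: "\<not> card {i. i < v \<and> w i = w' i} < k"
      from \<open>w \<in> word ` A\<close> \<open>w' \<in> word ` A\<close>
      obtain c c' where "c \<in> A" "c' \<in> A" "w = word c" "w' = word c'" by blast
      with * determined[of c c'] \<open>w \<noteq> w'\<close> show False by auto
    qed
  qed
qed

section \<open>The general bounds\<close>

lemma ex_copies_le_binomial:
  assumes "uniform_hypergraph k F" "edges F \<noteq> {}" "edges G \<noteq> {}"
  shows "ex_copies k F n G \<le> n choose k"
proof -
  obtain R :: "nat hypergraph" and \<C> where R: "uniform_hypergraph k R" "card (verts R) = n"
    "copy_union F R \<C>" "card \<C> = ex_copies k F n G"
    using ex_copies_attained[OF assms] by blast
  have "card \<C> * 1 \<le> card \<C> * card (edges F)"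
    using finite_edges[OF assms(1)] assms(2) by (intro mult_le_mono2) (simp add: Suc_le_eq card_gt_0_iff)
  then show ?thesis
    using copy_union_card(2)[OF R(1) assms(1,2) R(3)] card_edges_le[OF R(1)] R(2,4) by (metis le_trans mult.right_neutral)
qed

text \<open>First \<open>m\<close> is fixed so that the density at \<open>m\<close> is within
  \<open>\<epsilon> / 2\<close> of its infimum. Then \<open>n\<close> grows, and the bad
  \<open>m\<close>-sets, a fraction of order \<open>1 / n\<close>, cost another
  \<open>\<epsilon> / 2\<close>.\<close>

lemma ex_copies_upper:
  assumes "uniform_hypergraph k F" "edges F \<noteq> {}" "edges G \<noteq> {}" "\<epsilon> > 0"
  shows "eventually (\<lambda>n. real (card (edges F)) * real (ex_copies k F n G)
           \<le> real (turan_number k n G) + \<epsilon> * real n ^ k) sequentially"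
proof -
  define X where "X n = ex_copies k F n G" for n
  define T where "T n = turan_number k n G" for n
  define a where "a n = real (T n) / real (n choose k)" for n
  \<comment> \<open>The Turan density of \<open>G\<close>, taken as an infimum; it bounds every
    \<open>a n\<close> with \<open>n \<ge> k\<close> from below.\<close>
  define L where "L = Inf (a ` {k..})"
  define e where "e = card (edges F)"
  have bdd: "bdd_below (a ` {k..})" by (intro bdd_belowI[of _ 0]) (auto simp: a_def)
  have L_le: "L \<le> a n" if "n \<ge> k" for n
    unfolding L_def using that by (intro cInf_lower bdd) auto
  have "\<exists>m\<ge>k. a m < L + \<epsilon> / 2"
  proof -
    have "Inf (a ` {k..}) < L + \<epsilon> / 2" using assms(4) by (simp add: L_def)
    then show ?thesis by (subst (asm) cInf_less_iff) (use bdd in auto)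
  qed
  then obtain m0 where m0: "m0 \<ge> k" "a m0 < L + \<epsilon> / 2" by blast
  \<comment> \<open>The successor makes \<open>m > k\<close> strict, as sampling requires;
    monotonicity of the density preserves the bound.\<close>
  define m where "m = Suc m0"
  have m: "m > k" "a m < L + \<epsilon> / 2"
    using m0 turan_number_density_antimono[OF assms(3) m0(1), of m]
    unfolding m_def a_def T_def by auto
  \<comment> \<open>The bad term, divided by the product of \<open>n choose k\<close> and
    \<open>(n - k) choose (m - k)\<close>, is at most \<open>K / (n - k)\<close>.\<close>
  define K where "K = real (e\<^sup>2 * (m choose k) * (m - k))"
  show ?thesis
  proof (rule eventually_sequentiallyI)
    fix n assume n: "n \<ge> m + nat \<lceil>2 * K / \<epsilon>\<rceil>"
    then have nm: "n \<ge> m" "n > k" using m(1) by auto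
    have "2 * K / \<epsilon> \<le> real (nat \<lceil>2 * K / \<epsilon>\<rceil>)" by linarith
    also have "\<dots> \<le> real (n - k)" using n m(1) by linarith
    finally have small: "K / real (n - k) \<le> \<epsilon> / 2"
      using assms(4) nm by (simp add: field_simps)
    define B where "B = real ((n - k) choose (m - k))"
    define N where "N = real (n choose k)"
    have Bpos: "B > 0" using nm m(1) by (simp add: B_def zero_less_binomial_iff)
    have absorb: "real ((n - Suc k) choose (m - Suc k)) * real (n - k) = B * real (m - k)"
    proof -
      have "(m - k) * ((n - k) choose (m - k)) = (n - k) * ((n - k - 1) choose (m - k - 1))"
        using m(1) by (intro times_binomial_minus1_eq) simp
      then show ?thesis unfolding B_def by (simp add: mult.commute flip: of_nat_mult)
    qed
    have "real e * real (X n) * B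
        \<le> real (n choose m) * real (T m) + real (X n) * (real e)\<^sup>2 * real ((n - Suc k) choose (m - Suc k)) * real (m choose k)"
      using ex_copies_sampling[OF assms(1-3) m(1) nm(1)] unfolding X_def T_def e_def B_def
      by (metis (no_types, lifting) of_nat_le_iff of_nat_add of_nat_mult of_nat_power)
    also have "real (n choose m) * real (T m) = N * B * a m"
    proof -
      have "real (n choose m) * real (m choose k) = N * B"
        using choose_mult[of k m n] m(1) nm(1) unfolding N_def B_def by (metis of_nat_mult less_imp_le)
      moreover have "real (T m) = real (m choose k) * a m" using m(1) by (simp add: a_def)
      ultimately show ?thesis by simp
    qed
    also have "real (X n) * (real e)\<^sup>2 * real ((n - Suc k) choose (m - Suc k)) * real (m choose k)
        \<le> N * (real e)\<^sup>2 * real ((n - Suc k) choose (m - Suc k)) * real (m choose k)"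
      using ex_copies_le_binomial[OF assms(1-3), of n] unfolding X_def N_def
      by (intro mult_right_mono) auto
    also have "\<dots> = N * B * (K / real (n - k))"
    proof -
      have "real ((n - Suc k) choose (m - Suc k)) = B * real (m - k) / real (n - k)"
        using absorb nm by (simp add: field_simps)
      then show ?thesis by (simp add: K_def)
    qed
    also have "N * B * a m + N * B * (K / real (n - k)) = N * (a m + K / real (n - k)) * B"
      by (simp add: algebra_simps)
    finally have "real e * real (X n) \<le> N * (a m + K / real (n - k))" using Bpos by simp
    \<comment> \<open>The fixed \<open>m\<close> is traded for \<open>n\<close>: \<open>a m\<close>
      is below \<open>L + \<epsilon> / 2\<close>, and \<open>L\<close> is at most
      \<open>a n\<close>.\<close>
    also have "\<dots> \<le> N * (a n + \<epsilon>)"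
    proof (rule mult_left_mono)
      show "a m + K / real (n - k) \<le> a n + \<epsilon>" using m(2) small L_le[of n] nm by linarith
    qed (simp add: N_def)
    also have "\<dots> = real (T n) + \<epsilon> * N" using nm by (simp add: N_def a_def algebra_simps)
    also have "\<dots> \<le> real (T n) + \<epsilon> * real n ^ k"
      using binomial_le_pow[of k n] nm assms(4) unfolding N_def
      by (intro add_left_mono mult_left_mono) (auto simp flip: of_nat_power)
    finally show "real (card (edges F)) * real (ex_copies k F n G)
      \<le> real (turan_number k n G) + \<epsilon> * real n ^ k" by (simp add: e_def X_def T_def)
  qed
qed

section \<open>The lower bound\<close>

lemma ex_copies_ge_blowup:
  assumes "k \<ge> 1" "uniform_hypergraph k F" "edges F \<noteq> {}" "\<nexists>\<phi>. homomorphism \<phi> G F"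
    and "m \<ge> 1" "coprime m (fact (card (verts F)))" "card (verts F) * m \<le> n"
  shows "m ^ k \<le> ex_copies k F n G"
proof -
  define v where "v = card (verts F)"
  have fV: "finite (verts F)" using assms(2) by (simp add: uniform_hypergraph_def)
  obtain e0 where e0: "e0 \<in> edges F" using assms(3) by blast
  have kv: "k \<le> v" using uniform_hypergraph_edge[OF assms(2) e0] card_mono[OF fV] by (auto simp: v_def)
  obtain g where g: "bij_betw g (verts F) {0..<v}" using ex_bij_betw_finite_nat[OF fV] by (auto simp: v_def)
  obtain W :: "(nat \<Rightarrow> nat) set" where W: "finite W" "card W = m ^ k"
    "\<And>w i. w \<in> W \<Longrightarrow> w i < m"
    "\<And>w w'. w \<in> W \<Longrightarrow> w' \<in> W \<Longrightarrow> w \<noteq> w' \<Longrightarrow> card {i. i < v \<and> w i = w' i} < k"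
    using exists_mds_code[OF assms(1) kv assms(5) assms(6)[folded v_def]] by blast
  \<comment> \<open>The class of the blow-up belonging to \<open>x\<close> is the
    \<open>g x\<close>-th block of \<open>m\<close> consecutive numbers, and \<open>w\<close>
    selects one vertex in each block. Division by \<open>m\<close> recovers block and
    position.\<close>
  define emb where "emb w x = g x * m + w (g x)" for w x
  define copy where "copy w = \<lparr>verts = emb w ` verts F, edges = (`) (emb w) ` edges F\<rparr>" for w
  define R where "R = \<lparr>verts = {..<n}, edges = (\<Union>w\<in>W. edges (copy w))\<rparr>"
  have gv: "g x < v" if "x \<in> verts F" for x using g that by (auto simp: bij_betw_def)
  have decode: "emb w x div m = g x" "emb w x mod m = w (g x)" if "w \<in> W" for w x
    using W(3)[OF that, of "g x"] by (simp_all add: emb_def)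
  have inj: "inj_on (emb w) (verts F)" if "w \<in> W" for w
    using decode(1)[OF that] g by (metis inj_on_def bij_betw_def)
  have range: "emb w x < n" if "w \<in> W" "x \<in> verts F" for w x
  proof -
    have "emb w x < (g x + 1) * m" using W(3)[OF that(1), of "g x"] by (simp add: emb_def)
    also have "\<dots> \<le> v * m" using gv[OF that(2)] by (intro mult_le_mono1) simp
    finally show ?thesis using assms(7) by (simp add: v_def)
  qed
  have uni: "uniform_hypergraph k R"
  proof -
    have "emb w ` e \<subseteq> {..<n} \<and> card (emb w ` e) = k" if "w \<in> W" "e \<in> edges F" for w e
      using uniform_hypergraph_edge[OF assms(2) that(2)] range[OF that(1)]
        card_image[OF inj_on_subset[OF inj[OF that(1)]], of e] by auto
    then show ?thesis by (auto simp: uniform_hypergraph_def R_def copy_def)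
  qed
  have disjoint: "w = w'" if w: "w \<in> W" "w' \<in> W" and E: "E \<in> edges (copy w)" "E \<in> edges (copy w')" for w w' E
  proof (rule ccontr)
    assume "w \<noteq> w'"
    obtain e e' where e: "e \<in> edges F" "e' \<in> edges F" "E = emb w ` e" "E = emb w' ` e'"
      using E by (auto simp: copy_def)
    note e_sub = uniform_hypergraph_edge[OF assms(2) e(1)]
    \<comment> \<open>An edge shared by two copies makes their codewords agree at \<open>k\<close>
      positions, too many for distinct words.\<close>
    have "g ` e \<subseteq> {i. i < v \<and> w i = w' i}"
    proof clarify
      fix x assume x: "x \<in> e"
      then obtain y where "y \<in> e'" "emb w x = emb w' y" using e(3,4) by blast
      then have "g x = g y" "w (g x) = w' (g y)" using decode w by metis+
      then show "g x < v \<and> w (g x) = w' (g x)" using gv[of x] x e_sub(1) by auto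
    qed
    then have "card (g ` e) \<le> card {i. i < v \<and> w i = w' i}" by (intro card_mono) auto
    moreover have "card (g ` e) = k"
      using g e_sub by (metis card_image inj_on_subset bij_betw_def)
    ultimately show False using W(4)[OF w \<open>w \<noteq> w'\<close>] by simp
  qed
  have ne: "edges (copy w) \<noteq> {}" for w using assms(3) by (simp add: copy_def)
  have inj_copy: "inj_on copy W"
  proof (rule inj_onI)
    fix w w' assume "w \<in> W" "w' \<in> W" "copy w = copy w'"
    then show "w = w'" using disjoint[of w w'] ne[of w] by auto
  qed
  have "copy_union F R (copy ` W)"
    unfolding copy_union_def
  proof (intro conjI ballI)
    fix C assume "C \<in> copy ` W"
    then obtain w where w: "w \<in> W" "C = copy w" by blast
    show "is_copy F C R" unfolding w(2) copy_def
    proof (rule is_copy_image[OF assms(2) inj[OF w(1)]])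
      show "emb w ` verts F \<subseteq> verts R" using range[OF w(1)] by (auto simp: R_def)
      show "emb w ` e \<in> edges R" if "e \<in> edges F" for e
        using that w(1) by (auto simp: R_def copy_def)
    qed
  next
    show "pairwise (\<lambda>C D. edges C \<inter> edges D = {}) (copy ` W)"
      using disjoint by (auto simp: pairwise_def)
  qed (simp add: R_def)
  moreover have "\<nexists>S. is_copy G S R"
  proof
    assume "\<exists>S. is_copy G S R"
    then obtain h where h: "homomorphism h G R" by (auto elim: is_copy_homomorphism)
    obtain x0 where x0: "x0 \<in> verts F"
      using uniform_hypergraph_edge[OF assms(2) e0] assms(1) by (metis card.empty not_one_le_zero subsetD ex_in_conv)
    \<comment> \<open>The projection of the blow-up to \<open>F\<close>. Vertices beyond the
      \<open>v\<close> blocks lie in no edge but still need an image in \<open>verts F\<close>;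
      \<open>x0\<close> is their default.\<close>
    define \<pi> where "\<pi> y = (if y div m < v then inv_into (verts F) g (y div m) else x0)" for y
    have \<pi>_emb: "\<pi> (emb w x) = x" if "w \<in> W" "x \<in> verts F" for w x
      using decode[OF that(1)] gv[OF that(2)] g that(2) by (simp add: \<pi>_def bij_betw_def)
    have "inv_into (verts F) g i \<in> verts F" if "i < v" for i
      using g that by (intro inv_into_into) (auto simp: bij_betw_def)
    then have "\<pi> y \<in> verts F" for y using x0 by (simp add: \<pi>_def)
    moreover have "\<pi> ` E \<in> edges F" if "E \<in> edges R" for E
    proof -
      from that obtain w e where we: "w \<in> W" "e \<in> edges F" "E = emb w ` e" by (auto simp: R_def copy_def)
      have "\<pi> ` E = (\<lambda>x. \<pi> (emb w x)) ` e" by (simp add: we image_image)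
      also have "\<dots> = (\<lambda>x. x) ` e"
        using \<pi>_emb[OF we(1)] uniform_hypergraph_edge(1)[OF assms(2) we(2)] by (intro image_cong) auto
      finally show ?thesis using we(2) by simp
    qed
    ultimately have "homomorphism (\<pi> \<circ> h) G F"
      using h by (auto simp: homomorphism_def simp flip: image_image)
    with assms(4) show False by blast
  qed
  ultimately have "card (copy ` W) \<le> ex_copies k F n G"
    by (intro ex_copies_ge[OF assms(2,3) uni]) (auto simp: R_def)
  then show ?thesis using card_image[OF inj_copy] W(2) by simp
qed

text \<open>A multiple of \<open>fact v\<close> plus one is coprime to \<open>fact v\<close>.
  Rounding \<open>n / v\<close> down to such an \<open>m\<close> loses only a bounded amount, which
  is negligible after taking \<open>k\<close>-th powers.\<close>

lemma ex_copies_lower: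
  assumes "k \<ge> 1" "uniform_hypergraph k F" "edges F \<noteq> {}" "\<nexists>\<phi>. homomorphism \<phi> G F" "\<epsilon> > 0"
  shows "eventually (\<lambda>n. real n ^ k / real (card (verts F)) ^ k
           \<le> real (ex_copies k F n G) + \<epsilon> * real n ^ k) sequentially"
proof -
  define v where "v = card (verts F)"
  \<comment> \<open>Bounds the rounding loss: less than 1 from the integer division by
    \<open>v\<close>, and at most \<open>fact v\<close> from the residue condition on
    \<open>m\<close>.\<close>
  define D where "D = real (fact v + 2)"
  have v: "v \<ge> 1"
  proof -
    have "finite (verts F)" using assms(2) by (simp add: uniform_hypergraph_def)
    moreover have "verts F \<noteq> {}"
      using assms(1-3) uniform_hypergraph_edge[OF assms(2)]
      by (metis card.empty ex_in_conv not_one_le_zero subset_empty)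
    ultimately show ?thesis by (simp add: v_def Suc_le_eq card_gt_0_iff)
  qed
  have "((\<lambda>n. (1 / real v - D / real n) ^ k) \<longlongrightarrow> (1 / real v - 0) ^ k) sequentially"
    by (intro tendsto_power tendsto_diff tendsto_const lim_const_over_n)
  then have "eventually (\<lambda>n. (1 / real v - D / real n) ^ k > (1 / real v) ^ k - \<epsilon>) sequentially"
    using assms(5) by (intro order_tendstoD(1)[where y = "(1 / real v) ^ k"]) auto
  moreover have "eventually (\<lambda>n. real n \<ge> D * real v) sequentially"
    using eventually_ge_at_top[of "nat \<lceil>D * real v\<rceil>"]
    by eventually_elim linarith
  moreover have "eventually (\<lambda>n. n > 0) sequentially" by (rule eventually_gt_at_top)
  ultimately show ?thesis
  proof eventually_elim
    case (elim n)
    \<comment> \<open>Subtracting 1 before dividing leaves room for the \<open>+ 1\<close> in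
      \<open>m\<close>, so that \<open>m \<le> n div v\<close>.\<close>
    define q where "q = (n div v - 1) div fact v"
    define m where "m = q * fact v + 1"
    have nv: "real n / real v \<ge> D" using elim(2) v by (simp add: field_simps)
    have "real n / real v < real (n div v) + 1"
      using v by (metis floor_divide_of_nat_eq of_int_of_nat_eq real_of_int_floor_add_one_gt add.commute)
    moreover have big: "n div v \<ge> 1" using calculation nv unfolding D_def by linarith
    moreover have "n div v - 1 < q * fact v + fact v"
      unfolding q_def using dividend_less_div_times[of "fact v" "n div v - 1"] by simp
    ultimately have m_ge: "real m \<ge> real n / real v - D"
      unfolding m_def D_def by linarith
    have "q * fact v \<le> n div v - 1" unfolding q_def by (rule div_times_less_eq_dividend)
    then have "m \<le> n div v" using big unfolding m_def by linarith
    then have "v * m \<le> n" using v by (metis mult_le_mono2 le_trans times_div_less_eq_dividend)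
    moreover have "coprime m (fact v)" unfolding m_def
      by (metis coprime_1_left coprime_commute coprime_iff_gcd_eq_1 gcd_add_mult add.commute)
    ultimately have le: "m ^ k \<le> ex_copies k F n G"
      by (intro ex_copies_ge_blowup[OF assms(1-4)]) (auto simp: v_def m_def)
    have "real n ^ k * ((1 / real v) ^ k - \<epsilon>) \<le> real n ^ k * (1 / real v - D / real n) ^ k"
      using elim(1) by (intro mult_left_mono) auto
    also have "\<dots> = (real n / real v - D) ^ k"
      using elim(3) by (simp add: right_diff_distrib flip: power_mult_distrib)
    also have "\<dots> \<le> real m ^ k" using m_ge nv by (intro power_mono) auto
    also have "\<dots> \<le> real (ex_copies k F n G)" using le by (metis of_nat_le_iff of_nat_power)
    finally show ?case by (simp add: v_def algebra_simps power_divide)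
  qed
qed

section \<open>Complete partite hypergraphs and packings\<close>

lemma mem_listset: "xs \<in> listset As \<longleftrightarrow> list_all2 (\<in>) xs As"
proof (induction As arbitrary: xs)
  case (Cons A As)
  then show ?case by (cases xs) (auto simp: set_Cons_def)
qed auto

text \<open>
  Induction on \<open>k\<close>: among a bounded number \<open>w\<close> of heads of large degree, a positive
  proportion of the tails is joined to at least \<open>t\<close> of them, and by pigeonhole to the same
  \<open>t\<close>-set for a \<open>2\<^sup>-\<^sup>w\<close>-fraction of these.
\<close>

lemma dense_contains_box:
  assumes "\<epsilon> > 0"
  shows "\<exists>N. \<forall>(V :: 'a set) E. finite V \<longrightarrow> card V \<ge> N \<longrightarrow>
    E \<subseteq> {xs. set xs \<subseteq> V \<and> length xs = k} \<longrightarrow> real (card E) \<ge> \<epsilon> * real (card V) ^ k \<longrightarrow>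
    (\<exists>As. length As = k \<and> (\<forall>A\<in>set As. card A = t) \<and> listset As \<subseteq> E)"
  using assms
proof (induction k arbitrary: \<epsilon>)
  case 0
  show ?case
  proof (intro exI[of _ 0] allI impI exI[of _ "[]"] conjI)
    fix V :: "'a set" and E
    assume "E \<subseteq> {xs. set xs \<subseteq> V \<and> length xs = 0}" "real (card E) \<ge> \<epsilon> * real (card V) ^ 0"
    moreover from this have "E \<noteq> {}" using 0 by auto
    ultimately show "listset [] \<subseteq> E" by auto
  qed auto
next
  case (Suc k)
  \<comment> \<open>Chosen so that \<open>t \<le> w * \<epsilon> / 4\<close>: tails joined to fewer
    than \<open>t\<close> of the \<open>w\<close> heads then account for at most half of the
    guaranteed incidences.\<close>
  define w where "w = nat \<lceil>4 * real t / \<epsilon>\<rceil> + 1"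
  have wt: "real t \<le> real w * (\<epsilon> / 4)" and w0: "w > 0"
  proof -
    have "4 * real t / \<epsilon> \<le> real w" unfolding w_def by linarith
    then show "real t \<le> real w * (\<epsilon> / 4)" using Suc.prems by (simp add: field_simps)
  qed (simp add: w_def)
  \<comment> \<open>The density for the induction: good tails have density at least
    \<open>\<epsilon> / 4\<close>, and the pigeonhole over subsets of \<open>W\<close> costs
    \<open>2 ^ w\<close>.\<close>
  have "\<epsilon> / 4 / 2 ^ w > 0" using Suc.prems by simp
  from Suc.IH[OF this] obtain N where N: "\<And>(V :: 'a set) E. finite V \<Longrightarrow> card V \<ge> N \<Longrightarrow>
    E \<subseteq> {xs. set xs \<subseteq> V \<and> length xs = k} \<Longrightarrow> real (card E) \<ge> \<epsilon> / 4 / 2 ^ w * real (card V) ^ k \<Longrightarrow>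
    (\<exists>As. length As = k \<and> (\<forall>A\<in>set As. card A = t) \<and> listset As \<subseteq> E)" by blast
  show ?case
  proof (intro exI[of _ "max N (max 1 (nat \<lceil>2 * real w / \<epsilon>\<rceil>))"] allI impI)
    fix V :: "'a set" and E
    assume fV: "finite V" and big: "card V \<ge> max N (max 1 (nat \<lceil>2 * real w / \<epsilon>\<rceil>))"
      and E: "E \<subseteq> {xs. set xs \<subseteq> V \<and> length xs = Suc k}"
      and dense: "real (card E) \<ge> \<epsilon> * real (card V) ^ Suc k"
    define n where "n = card V"
    have n: "n \<ge> N" "n \<ge> 1" "n \<ge> nat \<lceil>2 * real w / \<epsilon>\<rceil>" using big by (auto simp: n_def)
    define L where "L = {xs. set xs \<subseteq> V \<and> length xs = k}"
    have L: "finite L" "card L = n ^ k"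
      unfolding L_def n_def using finite_lists_length_eq[OF fV] card_lists_length_eq[OF fV] by auto
    define deg where "deg x = card {xs\<in>L. x # xs \<in> E}" for x
    have deg_le: "deg x \<le> n ^ k" for x
      unfolding deg_def L(2)[symmetric] using L(1) by (intro card_mono) auto
    \<comment> \<open>Heads outside \<open>H\<close> contribute at most half of \<open>E\<close>, so
      \<open>H\<close> has at least \<open>\<epsilon> * n / 2\<close> elements, which is at least
      \<open>w\<close> for large \<open>n\<close>.\<close>
    define H where "H = {x\<in>V. real (deg x) \<ge> \<epsilon> / 2 * real n ^ k}"
    have "E \<subseteq> (\<lambda>(x, xs). x # xs) ` (SIGMA x:V. {xs\<in>L. x # xs \<in> E})"
      using E by (fastforce simp: L_def length_Suc_conv image_iff)
    moreover have "finite (SIGMA x:V. {xs\<in>L. x # xs \<in> E})" using fV L(1) by (intro finite_SigmaI) auto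
    ultimately have "card E \<le> card (SIGMA x:V. {xs\<in>L. x # xs \<in> E})" by (intro surj_card_le)
    also have "\<dots> = (\<Sum>x\<in>V. deg x)" using fV L(1) by (simp add: card_SigmaI deg_def)
    finally have "real (card E) \<le> (\<Sum>x\<in>V. real (deg x))" by (metis of_nat_le_iff of_nat_sum)
    also have "\<dots> \<le> (\<Sum>x\<in>V. (if x \<in> H then real n ^ k else 0) + \<epsilon> / 2 * real n ^ k)"
    proof (rule sum_mono)
      fix x assume "x \<in> V"
      then show "real (deg x) \<le> (if x \<in> H then real n ^ k else 0) + \<epsilon> / 2 * real n ^ k"
        using deg_le[of x] Suc.prems by (auto simp: H_def simp flip: of_nat_power intro: add_increasing2)
    qed
    also have "\<dots> = real (card H) * real n ^ k + real n * (\<epsilon> / 2 * real n ^ k)"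
      using fV by (simp add: sum.distrib sum.If_cases n_def) (simp add: H_def Int_def)
    finally have "\<epsilon> * real n * real n ^ k \<le> (real (card H) + real n * (\<epsilon> / 2)) * real n ^ k"
      using dense by (simp add: n_def algebra_simps)
    then have "\<epsilon> * real n \<le> real (card H) + real n * (\<epsilon> / 2)" using n(2) by simp
    then have "real (card H) \<ge> \<epsilon> * real n / 2" by (simp add: mult.commute)
    moreover have "\<epsilon> * real n / 2 \<ge> real w"
    proof -
      have "2 * real w / \<epsilon> \<le> real n" using n(3) by linarith
      then show ?thesis using Suc.prems by (simp add: field_simps)
    qed
    ultimately have "w \<le> card H" by linarith
    then obtain W where W: "W \<subseteq> H" "card W = w" "finite W" by (meson obtain_subset_with_card_n)
    define nb where "nb xs = {x\<in>W. x # xs \<in> E}" for xs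
    define good where "good = {xs\<in>L. card (nb xs) \<ge> t}"
    have "real w * (\<epsilon> / 2 * real n ^ k) \<le> (\<Sum>x\<in>W. real (deg x))"
      unfolding W(2)[symmetric] by (rule sum_bounded_below) (use W(1) in \<open>auto simp: H_def\<close>)
    also have "\<dots> = real (\<Sum>x\<in>W. card {xs\<in>L. x # xs \<in> E})" by (simp add: deg_def)
    also have "(\<Sum>x\<in>W. card {xs\<in>L. x # xs \<in> E}) = (\<Sum>xs\<in>L. card (nb xs))"
      unfolding nb_def by (rule sum_multicount_gen) (use W L in auto)
    also have "real \<dots> \<le> (\<Sum>xs\<in>L. (if xs \<in> good then real w else 0) + real t)"
      unfolding of_nat_sum
    proof (rule sum_mono)
      fix xs assume "xs \<in> L"
      moreover have "card (nb xs) \<le> w" unfolding W(2)[symmetric] nb_def using W(3) by (intro card_mono) auto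
      ultimately show "real (card (nb xs)) \<le> (if xs \<in> good then real w else 0) + real t"
        by (auto simp: good_def)
    qed
    also have "\<dots> = real w * real (card good) + real n ^ k * real t"
      using L by (simp add: sum.distrib sum.If_cases) (simp add: good_def Int_def)
    also have "\<dots> \<le> real w * real (card good) + real n ^ k * (real w * (\<epsilon> / 4))"
      using wt by (intro add_left_mono mult_left_mono) auto
    finally have "real w * (\<epsilon> / 4 * real n ^ k) \<le> real w * real (card good)" by (simp add: algebra_simps)
    then have good: "\<epsilon> / 4 * real n ^ k \<le> real (card good)" using w0 by simp
    have "\<forall>xs\<in>good. \<exists>T\<subseteq>nb xs. card T = t"
      unfolding good_def by (metis (no_types, lifting) mem_Collect_eq obtain_subset_with_card_n)
    then obtain T where T: "\<And>xs. xs \<in> good \<Longrightarrow> T xs \<subseteq> nb xs" "\<And>xs. xs \<in> good \<Longrightarrow> card (T xs) = t"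
      by metis
    \<comment> \<open>Each \<open>T xs\<close> is a subset of \<open>W\<close>, so at most
      \<open>2 ^ w\<close> values occur; if all of them were rare, \<open>good\<close> would be too
      small.\<close>
    have "\<exists>A. card A = t \<and> \<epsilon> / 4 / 2 ^ w * real n ^ k \<le> real (card {xs\<in>L. \<forall>x\<in>A. x # xs \<in> E})"
    proof (rule ccontr)
      assume *: "\<not> ?thesis"
      have fg: "finite good" unfolding good_def using L(1) by simp
      have "\<epsilon> / 4 * real n ^ k > 0" using n(2) Suc.prems by simp
      then have "good \<noteq> {}" using good by auto
      have "card good \<le> card (\<Union>A\<in>T ` good. {xs\<in>good. T xs = A})"
        using fg by (intro card_mono) auto
      also have "\<dots> \<le> (\<Sum>A\<in>T ` good. card {xs\<in>good. T xs = A})" using fg by (intro card_UN_le) auto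
      finally have "real (card good) \<le> (\<Sum>A\<in>T ` good. real (card {xs\<in>good. T xs = A}))"
        unfolding of_nat_sum[symmetric] of_nat_le_iff .
      also have "\<dots> < (\<Sum>A\<in>T ` good. \<epsilon> / 4 / 2 ^ w * real n ^ k)"
      proof (rule sum_strict_mono)
        fix A assume "A \<in> T ` good"
        then have "card A = t" using T(2) by auto
        have "card {xs\<in>good. T xs = A} \<le> card {xs\<in>L. \<forall>x\<in>A. x # xs \<in> E}"
          using L(1) T(1) by (intro card_mono) (auto simp: good_def nb_def)
        then have "real (card {xs\<in>good. T xs = A}) \<le> real (card {xs\<in>L. \<forall>x\<in>A. x # xs \<in> E})" by simp
        also have "\<dots> < \<epsilon> / 4 / 2 ^ w * real n ^ k"
          using * \<open>card A = t\<close> not_le by blast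
        finally show "real (card {xs\<in>good. T xs = A}) < \<epsilon> / 4 / 2 ^ w * real n ^ k" .
      qed (use fg \<open>good \<noteq> {}\<close> in auto)
      also have "\<dots> = real (card (T ` good)) * (\<epsilon> / 4 / 2 ^ w * real n ^ k)" by simp
      also have "\<dots> \<le> 2 ^ w * (\<epsilon> / 4 / 2 ^ w * real n ^ k)"
      proof (rule mult_right_mono)
        have "card (T ` good) \<le> card (Pow W)"
          using W(3) T(1) by (intro card_mono) (auto simp: nb_def)
        then show "real (card (T ` good)) \<le> 2 ^ w" using W by (simp add: card_Pow)
      qed (use Suc.prems in auto)
      finally show False using good by simp
    qed
    then obtain A where A: "card A = t"
      "\<epsilon> / 4 / 2 ^ w * real n ^ k \<le> real (card {xs\<in>L. \<forall>x\<in>A. x # xs \<in> E})" by blast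
    have "{xs\<in>L. \<forall>x\<in>A. x # xs \<in> E} \<subseteq> {xs. set xs \<subseteq> V \<and> length xs = k}" by (auto simp: L_def)
    from N[OF fV _ this] n(1) A(2) obtain As where As: "length As = k" "\<forall>A\<in>set As. card A = t"
      "listset As \<subseteq> {xs\<in>L. \<forall>x\<in>A. x # xs \<in> E}" unfolding n_def by blast
    show "\<exists>As. length As = Suc k \<and> (\<forall>A\<in>set As. card A = t) \<and> listset As \<subseteq> E"
      using As A(1) by (intro exI[of _ "A # As"]) (auto simp: set_Cons_def)
  qed
qed

text \<open>A box inside the set of ordered edges has pairwise disjoint sides, because its tuples
  are repetition-free. Each class of \<open>F\<close> is injected into one side, and an edge of
  \<open>F\<close>, meeting every class once, lands on a tuple of the box.\<close>

lemma k_partite_copy_in_dense: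
  fixes F :: "'a hypergraph"
  assumes "uniform_hypergraph k F" "verts F \<noteq> {}" "k_partite k F" "\<epsilon> > 0"
  shows "\<exists>N. \<forall>R :: 'b hypergraph. uniform_hypergraph k R \<longrightarrow> card (verts R) \<ge> N \<longrightarrow>
    real (card (edges R)) \<ge> \<epsilon> * real (card (verts R)) ^ k \<longrightarrow> (\<exists>S. is_copy F S R)"
proof -
  \<comment> \<open>Sides as large as all of \<open>F\<close>, a crude size that accommodates every
    class.\<close>
  define t where "t = card (verts F)"
  have fF: "finite (verts F)" using assms(1) by (simp add: uniform_hypergraph_def)
  have t: "t > 0" using fF assms(2) by (simp add: t_def card_gt_0_iff)
  obtain P where P: "partition_on (verts F) P" "card P = k"
    "\<And>e A. e \<in> edges F \<Longrightarrow> A \<in> P \<Longrightarrow> card (e \<inter> A) = 1"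
    using assms(3) by (auto simp: k_partite_def)
  have "finite P" using finite_elements[OF fF P(1)] .
  then obtain Ps where Ps: "set Ps = P" "distinct Ps" "length Ps = k"
    using P(2) by (metis finite_distinct_list distinct_card)
  obtain N where N: "\<And>(V :: 'b set) E. finite V \<Longrightarrow> card V \<ge> N \<Longrightarrow>
    E \<subseteq> {xs. set xs \<subseteq> V \<and> length xs = k} \<Longrightarrow> real (card E) \<ge> \<epsilon> * real (card V) ^ k \<Longrightarrow>
    (\<exists>As. length As = k \<and> (\<forall>A\<in>set As. card A = t) \<and> listset As \<subseteq> E)"
    using dense_contains_box[OF assms(4), where t = t and k = k and 'a = 'b] by blast
  show ?thesis
  proof (intro exI[of _ N] allI impI)
    fix R :: "'b hypergraph"
    assume R: "uniform_hypergraph k R" "card (verts R) \<ge> N"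
      "real (card (edges R)) \<ge> \<epsilon> * real (card (verts R)) ^ k"
    define E where "E = {xs. distinct xs \<and> set xs \<in> edges R}"
    have E: "E \<subseteq> {xs. set xs \<subseteq> verts R \<and> length xs = k}"
      using uniform_hypergraph_edge[OF R(1)] by (auto simp: E_def dest: distinct_card)
    have fV: "finite (verts R)" using R(1) by (simp add: uniform_hypergraph_def)
    have "finite E" using E finite_lists_length_eq[OF fV] by (rule finite_subset)
    moreover have "edges R \<subseteq> set ` E"
    proof
      fix e assume e: "e \<in> edges R"
      then obtain xs where "set xs = e" "distinct xs"
        using uniform_hypergraph_edge(3)[OF R(1)] finite_distinct_list by blast
      then show "e \<in> set ` E" using e by (auto simp: E_def)
    qed
    ultimately have "card (edges R) \<le> card E" by (rule surj_card_le)
    then have "real (card E) \<ge> \<epsilon> * real (card (verts R)) ^ k" using R(3) by linarith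
    from N[OF fV R(2) E this] obtain As where As: "length As = k" "\<And>A. A \<in> set As \<Longrightarrow> card A = t"
      "listset As \<subseteq> E" by blast
    have transversal: "map y [0..<k] \<in> E" if "\<And>i. i < k \<Longrightarrow> y i \<in> As ! i" for y
      using that As(1,3) by (auto simp: mem_listset list_all2_conv_all_nth)
    have A: "finite (As ! i)" "card (As ! i) = t" "As ! i \<noteq> {}" if "i < k" for i
    proof -
      show "card (As ! i) = t" using As(1,2) that by simp
      with t show "finite (As ! i)" "As ! i \<noteq> {}" by (auto intro: card_ge_0_finite)
    qed
    then have "\<forall>i<k. \<exists>x. x \<in> As ! i" by blast
    then obtain z where z: "\<And>i. i < k \<Longrightarrow> z i \<in> As ! i" by metis
    have A_sub: "As ! i \<subseteq> verts R" if "i < k" for i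
    proof
      fix x assume "x \<in> As ! i"
      then have "map (z(i := x)) [0..<k] \<in> E" using z by (intro transversal) auto
      then have "(z(i := x)) i \<in> verts R" using E that by auto
      then show "x \<in> verts R" by simp
    qed
    have A_disjoint: "i = j" if "i < k" "j < k" "x \<in> As ! i" "x \<in> As ! j" for i j x
    proof (rule ccontr)
      assume "i \<noteq> j"
      \<comment> \<open>A common vertex of two sides could be used in both coordinates, giving a
        tuple with a repeated entry.\<close>
      have "map (z(i := x, j := x)) [0..<k] \<in> E" using z that by (intro transversal) auto
      then have "inj_on (z(i := x, j := x)) {0..<k}" by (auto simp: E_def distinct_map)
      then show False using that(1,2) \<open>i \<noteq> j\<close> by (auto dest!: inj_onD[where x = i and y = j])
    qed
    have class_sub: "Ps ! i \<subseteq> verts F" if "i < k" for i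
      using partition_onD1[OF P(1)] Ps that by (metis Union_upper nth_mem)
    have "\<exists>f. f ` (Ps ! i) \<subseteq> As ! i \<and> inj_on f (Ps ! i)" if "i < k" for i
    proof (rule card_le_inj)
      show "finite (Ps ! i)" using class_sub[OF that] fF by (rule finite_subset)
      show "card (Ps ! i) \<le> card (As ! i)" using class_sub[OF that] fF A that by (simp add: t_def card_mono)
    qed (use A that in auto)
    then obtain g where g: "\<And>i. i < k \<Longrightarrow> g i ` (Ps ! i) \<subseteq> As ! i" "\<And>i. i < k \<Longrightarrow> inj_on (g i) (Ps ! i)"
      by metis
    have "\<exists>i<k. x \<in> Ps ! i" if "x \<in> verts F" for x
      using partition_onD1[OF P(1)] Ps that by (metis Union_iff in_set_conv_nth)
    then obtain c where c: "\<And>x. x \<in> verts F \<Longrightarrow> c x < k" "\<And>x. x \<in> verts F \<Longrightarrow> x \<in> Ps ! c x" by metis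
    have c_unique: "c x = i" if "i < k" "x \<in> Ps ! i" for x i
    proof -
      have x: "x \<in> verts F" using class_sub that by blast
      then have "Ps ! c x = Ps ! i"
        using partition_onD2[OF P(1)] c[OF x] that Ps by (metis disjointD disjoint_iff nth_mem)
      then show ?thesis using Ps c[OF x] that by (simp add: nth_eq_iff_index_eq)
    qed
    define f where "f x = g (c x) x" for x
    have f_in: "f x \<in> As ! c x" if "x \<in> verts F" for x using g(1)[OF c(1)[OF that]] c(2)[OF that] by (auto simp: f_def)
    have "inj_on f (verts F)"
    proof (rule inj_onI)
      fix x y assume xy: "x \<in> verts F" "y \<in> verts F" "f x = f y"
      then have "c x = c y" using A_disjoint f_in c by metis
      then show "x = y" using g(2)[of "c x"] c xy by (metis f_def inj_onD)
    qed
    moreover have "f ` verts F \<subseteq> verts R" using f_in A_sub c by blast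
    moreover have "f ` e \<in> edges R" if "e \<in> edges F" for e
    proof -
      have "\<exists>y. e \<inter> Ps ! i = {y}" if "i < k" for i
        using P(3)[OF \<open>e \<in> edges F\<close>, of "Ps ! i"] Ps that by (metis nth_mem card_1_singletonE)
      \<comment> \<open>\<open>y\<close> lists the edge \<open>e\<close> class by class, which turns
        its image into a tuple of the box.\<close>
      then obtain y where y: "\<And>i. i < k \<Longrightarrow> e \<inter> Ps ! i = {y i}" by metis
      have "f (y i) \<in> As ! i" if "i < k" for i
      proof -
        have "y i \<in> Ps ! i" using y[OF that] by blast
        then show ?thesis using f_in[of "y i"] c_unique[OF that, of "y i"] class_sub[OF that] by auto
      qed
      then have "map (\<lambda>i. f (y i)) [0..<k] \<in> E" by (rule transversal)
      then have "(\<lambda>i. f (y i)) ` {0..<k} \<in> edges R" by (simp add: E_def)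
      moreover have "y ` {0..<k} = e"
      proof
        show "y ` {0..<k} \<subseteq> e" using y by fastforce
        show "e \<subseteq> y ` {0..<k}"
        proof
          fix x assume x: "x \<in> e"
          then have "x \<in> verts F" using uniform_hypergraph_edge(1)[OF assms(1) that] by blast
          then have "x = y (c x)" "c x < k" using y[of "c x"] c x by auto
          then show "x \<in> y ` {0..<k}" by auto
        qed
      qed
      ultimately show ?thesis by (metis image_image)
    qed
    ultimately show "\<exists>S. is_copy F S R" using is_copy_image[OF assms(1)] by blast
  qed
qed

section \<open>Packing copies of \<open>F\<close> greedily\<close>

lemma maximal_packing:
  assumes "uniform_hypergraph k H" "uniform_hypergraph k F" "edges F \<noteq> {}"
  obtains \<C> where "copy_union F (H\<lparr>edges := \<Union>(edges ` \<C>)\<rparr>) \<C>" "\<Union>(edges ` \<C>) \<subseteq> edges H"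
    "\<nexists>S. is_copy F S (H\<lparr>edges := edges H - \<Union>(edges ` \<C>)\<rparr>)"
proof -
  define Q where "Q \<C> \<longleftrightarrow> copy_union F (H\<lparr>edges := \<Union>(edges ` \<C>)\<rparr>) \<C> \<and> \<Union>(edges ` \<C>) \<subseteq> edges H" for \<C>
  have epos: "card (edges F) \<ge> 1" using finite_edges[OF assms(2)] assms(3) by (simp add: Suc_le_eq card_gt_0_iff)
  have fH: "finite (edges H)" by (rule finite_edges[OF assms(1)])
  have Q: "finite \<C>" "card \<C> \<le> card (edges H)" if "Q \<C>" for \<C>
  proof -
    let ?R = "H\<lparr>edges := \<Union>(edges ` \<C>)\<rparr>"
    have "uniform_hypergraph k ?R" using assms(1) that by (auto simp: uniform_hypergraph_def Q_def)
    note cu = copy_union_card[OF this assms(2,3), of \<C>]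
    show "finite \<C>" using cu that by (simp add: Q_def)
    have "card \<C> * 1 \<le> card \<C> * card (edges F)" using epos by (rule mult_le_mono2)
    also have "\<dots> = card (\<Union>(edges ` \<C>))" using cu that by (simp add: Q_def)
    also have "\<dots> \<le> card (edges H)" using that fH by (intro card_mono) (auto simp: Q_def)
    finally show "card \<C> \<le> card (edges H)" by simp
  qed
  have "Q {}" by (simp add: Q_def copy_union_def)
  then obtain \<C> where \<C>: "Q \<C>" "\<And>\<D>. Q \<D> \<Longrightarrow> card \<D> \<le> card \<C>"
    using ex_has_greatest_nat[of Q "{}" card "card (edges H) + 1"] Q(2) by (metis less_Suc_eq_le Suc_eq_plus1)
  show thesis
  proof (rule that)
    show "copy_union F (H\<lparr>edges := \<Union>(edges ` \<C>)\<rparr>) \<C>" "\<Union>(edges ` \<C>) \<subseteq> edges H"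
      using \<C>(1) by (auto simp: Q_def)
    show "\<nexists>S. is_copy F S (H\<lparr>edges := edges H - \<Union>(edges ` \<C>)\<rparr>)"
    proof
      assume "\<exists>S. is_copy F S (H\<lparr>edges := edges H - \<Union>(edges ` \<C>)\<rparr>)"
      then obtain S where S: "is_copy F S (H\<lparr>edges := edges H - \<Union>(edges ` \<C>)\<rparr>)" by blast
      then have S_edges: "edges S \<subseteq> edges H - \<Union>(edges ` \<C>)" by (simp add: is_copy_def subhypergraph_def)
      have "S \<notin> \<C>"
      proof
        assume "S \<in> \<C>"
        then have "edges S = {}" using S_edges by blast
        then show False using is_copy_card_edges[OF assms(2) S] epos by simp
      qed
      moreover have "Q (insert S \<C>)"
      proof -
        have "is_copy F S (H\<lparr>edges := edges S \<union> \<Union>(edges ` \<C>)\<rparr>)"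
          using S by (auto simp: is_copy_def subhypergraph_def)
        moreover have "is_copy F C (H\<lparr>edges := edges S \<union> \<Union>(edges ` \<C>)\<rparr>)" if "C \<in> \<C>" for C
          using \<C>(1) that by (auto simp: Q_def copy_union_def is_copy_def subhypergraph_def)
        moreover have "pairwise (\<lambda>C D. edges C \<inter> edges D = {}) (insert S \<C>)"
          using \<C>(1) S_edges by (auto simp: Q_def copy_union_def pairwise_insert)
        ultimately show ?thesis using \<C>(1) S_edges by (auto simp: Q_def copy_union_def)
      qed
      ultimately show False using \<C>(2)[of "insert S \<C>"] Q(1)[OF \<C>(1)] by simp
    qed
  qed
qed

lemma turan_number_le_ex_copies:
  assumes "uniform_hypergraph k F" "edges F \<noteq> {}" "edges G \<noteq> {}" "verts F \<noteq> {}" "k_partite k F" "\<epsilon> > 0"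
  shows "eventually (\<lambda>n. real (turan_number k n G)
    \<le> real (card (edges F)) * real (ex_copies k F n G) + \<epsilon> * real n ^ k) sequentially"
proof -
  obtain N where N: "\<And>R :: nat hypergraph. uniform_hypergraph k R \<Longrightarrow> card (verts R) \<ge> N \<Longrightarrow>
    real (card (edges R)) \<ge> \<epsilon> * real (card (verts R)) ^ k \<Longrightarrow> \<exists>S. is_copy F S R"
    using k_partite_copy_in_dense[OF assms(1,4,5,6), where 'b = nat] by blast
  show ?thesis
  proof (rule eventually_sequentiallyI[of N])
    fix n assume n: "n \<ge> N"
    obtain H :: "nat hypergraph" where H: "uniform_hypergraph k H" "card (verts H) = n"
      "\<nexists>S. is_copy G S H" "card (edges H) = turan_number k n G"
      using turan_number_attained[OF assms(3)] .
    obtain \<C> where \<C>: "copy_union F (H\<lparr>edges := \<Union>(edges ` \<C>)\<rparr>) \<C>" "\<Union>(edges ` \<C>) \<subseteq> edges H"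
      "\<nexists>S. is_copy F S (H\<lparr>edges := edges H - \<Union>(edges ` \<C>)\<rparr>)"
      using maximal_packing[OF H(1) assms(1,2)] .
    let ?R = "H\<lparr>edges := \<Union>(edges ` \<C>)\<rparr>" and ?R' = "H\<lparr>edges := edges H - \<Union>(edges ` \<C>)\<rparr>"
    have uni: "uniform_hypergraph k ?R" "uniform_hypergraph k ?R'"
      using H(1) \<C>(2) by (auto simp: uniform_hypergraph_def)
    have few: "real (card (edges ?R')) < \<epsilon> * real n ^ k"
      using N[OF uni(2)] \<C>(3) H(2) n by fastforce
    have "\<nexists>S. is_copy G S ?R" using H(3) \<C>(2) is_copy_mono[of G _ ?R H] by auto
    then have "card \<C> \<le> ex_copies k F n G"
      using H(2) by (intro ex_copies_ge[OF assms(1,2) uni(1) _ \<C>(1)]) auto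
    then have "card (\<Union>(edges ` \<C>)) \<le> card (edges F) * ex_copies k F n G"
      using copy_union_card(2)[OF uni(1) assms(1,2) \<C>(1)] by (simp add: mult.commute)
    moreover have "card (edges H) = card (\<Union>(edges ` \<C>)) + card (edges ?R')"
      using \<C>(2) finite_edges[OF H(1)] by (simp add: card_Diff_subset finite_subset card_mono)
    ultimately have "turan_number k n G \<le> card (edges F) * ex_copies k F n G + card (edges ?R')"
      using H(4) by simp
    then have "real (turan_number k n G) \<le> real (card (edges F)) * real (ex_copies k F n G) + real (card (edges ?R'))"
      by (metis of_nat_le_iff of_nat_add of_nat_mult)
    then show "real (turan_number k n G)
        \<le> real (card (edges F)) * real (ex_copies k F n G) + \<epsilon> * real n ^ k"
      using few by linarith
  qed
qed

text \<open>The error is the positive part of \<open>a n - b n\<close>: it absorbs the finitely many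
  exceptional \<open>n\<close> for each \<open>\<epsilon>\<close>, and it stays small even where
  \<open>a n\<close> is far below \<open>b n\<close>.\<close>

lemma smallo_error_if_eventually_le:
  fixes a b g :: "nat \<Rightarrow> real"
  assumes "\<And>\<epsilon>. \<epsilon> > 0 \<Longrightarrow> eventually (\<lambda>n. a n \<le> b n + \<epsilon> * \<bar>g n\<bar>) sequentially"
  shows "\<exists>h\<in>o(g). \<forall>n. a n \<le> b n + h n"
proof (intro bexI allI)
  show "(\<lambda>n. max 0 (a n - b n)) \<in> o(g)"
  proof (rule landau_o.smallI)
    fix c :: real assume "c > 0"
    from assms[OF this] show "eventually (\<lambda>n. norm (max 0 (a n - b n)) \<le> c * norm (g n)) sequentially"
      by eventually_elim (use \<open>c > 0\<close> in auto)
  qed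
qed auto

theorem theorem1p13:
  fixes k :: nat and G :: "'a hypergraph" and F :: "'b hypergraph"
  assumes "k \<ge> 2"
    and "uniform_hypergraph k G"
    and "uniform_hypergraph k F"
    and "edges F \<noteq> {}"
    and "\<nexists>\<phi>. homomorphism \<phi> G F"
  shows "(\<exists>f\<in>o(\<lambda>n. real n ^ k). \<forall>n.
            real n ^ k / real (card (verts F)) ^ k + f n \<le> real (ex_copies k F n G)) \<and>
         (\<exists>g\<in>o(\<lambda>n. real n ^ k). \<forall>n.
            real (ex_copies k F n G)
              \<le> inverse (real (card (edges F))) * real (turan_number k n G) + g n) \<and>
         (k_partite k F \<longrightarrow>
            (\<exists>h\<in>o(\<lambda>n. real n ^ k). \<forall>n.
               real (ex_copies k F n G)
                 = inverse (real (card (edges F))) * real (turan_number k n G) + h n))"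
proof -
  let ?X = "\<lambda>n. real (ex_copies k F n G)" and ?T = "\<lambda>n. real (turan_number k n G)"
  let ?e = "real (card (edges F))"
  have k: "k \<ge> 1" using assms(1) by simp
  have neG: "edges G \<noteq> {}" by (rule edges_nonempty_if_no_homomorphism[OF k assms(3-5)])
  have neV: "verts F \<noteq> {}"
    using k assms(4) uniform_hypergraph_edge[OF assms(3)]
    by (metis card.empty ex_in_conv not_one_le_zero subset_empty)
  have e: "?e > 0" using finite_edges[OF assms(3)] assms(4) by (simp add: card_gt_0_iff)
  have upper: "eventually (\<lambda>n. ?X n \<le> inverse ?e * ?T n + \<epsilon> * real n ^ k) sequentially" if "\<epsilon> > 0" for \<epsilon>
  proof -
    \<comment> \<open>The tolerance is scaled by the number of edges of \<open>F\<close>, so that it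
      becomes \<open>\<epsilon>\<close> after division.\<close>
    have "?e * \<epsilon> > 0" using e that by simp
    from ex_copies_upper[OF assms(3,4) neG this] show ?thesis
      by eventually_elim (use e in \<open>simp add: field_simps\<close>)
  qed
  have part1: "\<exists>f\<in>o(\<lambda>n. real n ^ k). \<forall>n. real n ^ k / real (card (verts F)) ^ k + f n \<le> ?X n"
  proof -
    obtain h where h: "h \<in> o(\<lambda>n. real n ^ k)" "\<And>n. real n ^ k / real (card (verts F)) ^ k \<le> ?X n + h n"
      using smallo_error_if_eventually_le[of "\<lambda>n. real n ^ k / real (card (verts F)) ^ k" ?X "\<lambda>n. real n ^ k"]
        ex_copies_lower[OF k assms(3-5)] by auto
    show ?thesis
    proof (intro bexI[of _ "\<lambda>n. - h n"] allI)
      show "real n ^ k / real (card (verts F)) ^ k + - h n \<le> ?X n" for n using h(2)[of n] by simp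
    qed (use h(1) in simp)
  qed
  have part2: "\<exists>g\<in>o(\<lambda>n. real n ^ k). \<forall>n. ?X n \<le> inverse ?e * ?T n + g n"
    using upper by (intro smallo_error_if_eventually_le) simp
  have part3: "\<exists>h\<in>o(\<lambda>n. real n ^ k). \<forall>n. ?X n = inverse ?e * ?T n + h n" if "k_partite k F"
  proof (intro bexI allI)
    \<comment> \<open>The error term is the exact difference; the two one-sided eventual bounds
      control its absolute value.\<close>
    show "(\<lambda>n. ?X n - inverse ?e * ?T n) \<in> o(\<lambda>n. real n ^ k)"
    proof (rule landau_o.smallI)
      fix c :: real assume c: "c > 0"
      then have "?e * c > 0" using e by simp
      from turan_number_le_ex_copies[OF assms(3,4) neG neV that this]
      have "eventually (\<lambda>n. inverse ?e * ?T n \<le> ?X n + c * real n ^ k) sequentially"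
        by eventually_elim (use e in \<open>simp add: field_simps\<close>)
      with upper[OF c] show "eventually (\<lambda>n. norm (?X n - inverse ?e * ?T n) \<le> c * norm (real n ^ k)) sequentially"
        by eventually_elim (simp add: abs_le_iff)
    qed
  qed simp
  show ?thesis using part1 part2 part3 by blast
qed

end
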